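(* Let $\mathbb{F}$ be an algebraically closed field of prime characteristic $p>2$, and let $L$ be the root lattice of type $A_n$ with $n+1\equiv 0\pmod p$. Write $n+1=ap^r$ with $a,r$ positive integers and $\gcd(a,p)=1$, let $\Pi=\{\alpha_1,\dots,\alpha_n\}$ be the simple roots and $\eta=\alpha_1+2\alpha_2+\cdots+n\alpha_n$. Let $I_L\subset V_{L,\mathbb F}$ be the vector space spanned by the elements $$s_{\alpha^1,m_1}\cdots s_{\alpha^k,m_k}s_{\eta,m}\iota(e_\alpha),$$ where $\alpha\in L$, $\alpha^i\in\Pi$, $m_i\in\mathbb Z_+$, $k\in\mathbb N$, and $m\in\mathbb Z_+$ with $p^r\nmid m$. Then $I_L\subset\operatorname{Rad}(\cdot,\cdot)_{V_{L,\mathbb F}}$.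
   Context: $\mathbb N=\{0,1,2,\dots\}$, $\mathbb Z_+=\{1,2,\dots\}$. **Lattice vertex algebra.** $L=\bigoplus_{i=1}^n\mathbb Z\alpha_i$ with $\langle\alpha_i,\alpha_i\rangle=2$, $\langle\alpha_i,\alpha_{i\pm1}\rangle=-1$, and $\langle\alpha_i,\alpha_j\rangle=0$ otherwise. Let $\mathfrak h_{\mathbb C}=\mathbb C\otimes_{\mathbb Z}L$. Over $\mathbb C$, $V_L=S(t^{-1}\mathfrak h_{\mathbb C}[t^{-1}])\otimes\mathbb C\{L\}$, where $\mathbb C\{L\}$ has basis $\{\iota(e_\alpha)\mid\alpha\in L\}$ and $\mathbf 1=1\otimes\iota(e_0)$. For $h\in\mathfrak h_{\mathbb C}$, $m>0$: $h(-m)$ is multiplication by $h\otimes t^{-m}$; $h(m)$ acts as the derivation of $S(t^{-1}\mathfrak h_{\mathbb C}[t^{-1}])$ with $h(m)\cdot h'(-k)=m\langle h,h'\rangle\delta_{m,k}$. For $\alpha\in L$, define operators $s_{\alpha,m},r_{\alpha,m}$ by $E^-(-\alpha,x)=\exp\left(\sum_{m\ge1}\frac{\alpha(-m)}{m}x^m\right)=\sum_{m\ge0}s_{\alpha,m}x^m$, $E^+(-\alpha,x)=\exp\left(\sum_{m\ge1}\frac{-\alpha(m)}{m}x^{-m}\right)=\sum_{m\ge0}r_{\alpha,m}x^{-m}$; write $s_{\alpha,m}$ also for $s_{\alpha,m}\mathbf 1$. The $\mathbb Z$-span $V_{L,\mathbb Z}$ of the elements $s_{\alpha^1,m_1}\cdots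 s_{\alpha^k,m_k}\iota(e_\alpha)$ ($k\in\mathbb N$, $\alpha^i\in\Pi$, $m_i\in\mathbb Z_+$, $\alpha\in L$) has these elements as a $\mathbb Z$-basis, is an integral form of the lattice vertex algebra $V_L$, and is preserved by all $s_{\alpha,m},r_{\alpha,m}$ ($\alpha\in L$). Put $V_{L,\mathbb F}=V_{L,\mathbb Z}\otimes_{\mathbb Z}\mathbb F$. **Bilinear form.** $(\cdot,\cdot)_{V_{L,\mathbb F}}$ is the symmetric bilinear form on $V_{L,\mathbb F}$ determined by $(\iota(e_\alpha),\iota(e_\beta))_{V_{L,\mathbb F}}=\delta_{\alpha,-\beta}$ for $\alpha,\beta\in L$ and $(s_{\alpha,m}u,v)_{V_{L,\mathbb F}}=(u,r_{\alpha,m}v)_{V_{L,\mathbb F}}$ for $u,v\in V_{L,\mathbb F}$, $\alpha\in L$, $m\in\mathbb N$. Its radical is $\operatorname{Rad}(\cdot,\cdot)_{V_{L,\mathbb F}}=\{v\in V_{L,\mathbb F}\mid(v,u)_{V_{L,\mathbb F}}=0\text{ for all }u\in V_{L,\mathbb F}\}$. *)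

theory Defs
  imports
    Complex_Main
    "HOL-Library.Poly_Mapping"
    "HOL-Computational_Algebra.Computational_Algebra"
    "HOL-Computational_Algebra.Group_Closure"
    "HOL-Number_Theory.Cong"
begin

section \<open>The root lattice of type A\<close>

text \<open>
  A vector in the root lattice is given by its coordinates with respect to the simple roots
  \<open>\<alpha>\<^sub>1, \<alpha>\<^sub>2, \<dots>\<close>. The rank \<open>n\<close> is a value, so the lattice of type \<open>A\<^sub>n\<close>
  is the set of coordinate vectors supported on \<open>{1..n}\<close>.
\<close>

type_synonym lat = "nat \<Rightarrow>\<^sub>0 int"
type_synonym cartan_vec = "nat \<Rightarrow>\<^sub>0 complex"

definition root_lattice :: "nat \<Rightarrow> lat set" where
  "root_lattice n = {\<alpha>. Poly_Mapping.keys \<alpha> \<subseteq> {1..n}}"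

definition simple_root :: "nat \<Rightarrow> lat" where
  "simple_root i = Poly_Mapping.single i 1"

definition simple_roots :: "nat \<Rightarrow> lat set" where
  "simple_roots n = simple_root ` {1..n}"

definition eta :: "nat \<Rightarrow> lat" where
  "eta n = (\<Sum>i=1..n. Poly_Mapping.single i (int i))"

definition cartan_A :: "nat \<Rightarrow> nat \<Rightarrow> int" where
  "cartan_A i j = (if i = j then 2 else if i = Suc j \<or> j = Suc i then -1 else 0)"

text \<open>The complexification of the lattice, with the complex bilinear extension of its form.\<close>

definition to_cartan :: "lat \<Rightarrow> cartan_vec" where
  "to_cartan \<alpha> = Poly_Mapping.map of_int \<alpha>"

definition cartan_form :: "cartan_vec \<Rightarrow> cartan_vec \<Rightarrow> complex" where
  "cartan_form h h' = (\<Sum>i\<in>Poly_Mapping.keys h. \<Sum>j\<in>Poly_Mapping.keys h'.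
     Poly_Mapping.lookup h i * Poly_Mapping.lookup h' j * of_int (cartan_A i j))"


section \<open>The symmetric algebra and the Heisenberg operators\<close>

text \<open>
  The symmetric algebra on \<open>t\<^sup>-\<^sup>1 \<hh>[t\<^sup>-\<^sup>1]\<close> is the polynomial algebra in the variables
  \<open>(i, m)\<close>, which stand for \<open>\<alpha>\<^sub>i \<otimes> t\<^sup>-\<^sup>m\<close> with \<open>m > 0\<close>. It is realised as the
  monoid algebra of the monomials, whose multiplication is that of \<^typ>\<open>'a \<Rightarrow>\<^sub>0 'b\<close>.
\<close>

type_synonym heis_var = "nat \<times> nat"
type_synonym sym = "(heis_var \<Rightarrow>\<^sub>0 nat) \<Rightarrow>\<^sub>0 complex"

definition sym_var :: "heis_var \<Rightarrow> sym" where
  "sym_var v = Poly_Mapping.single (Poly_Mapping.single v 1) 1"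

definition sym_scale :: "complex \<Rightarrow> sym \<Rightarrow> sym" where
  "sym_scale c f = Poly_Mapping.map ((*) c) f"

text \<open>The element \<open>h \<otimes> t\<^sup>-\<^sup>m\<close> of the symmetric algebra.\<close>

definition sym_elem :: "cartan_vec \<Rightarrow> nat \<Rightarrow> sym" where
  "sym_elem h m = (\<Sum>i\<in>Poly_Mapping.keys h. sym_scale (Poly_Mapping.lookup h i) (sym_var (i, m)))"

text \<open>
  The linear derivation of the symmetric algebra sending the variable \<open>v\<close> to the constant
  \<open>d v\<close>: a monomial \<open>X\<^sup>M\<close> is sent to \<open>\<Sum>\<^sub>v M(v) d(v) X\<^sup>M\<^sup>-\<^sup>v\<close>.
\<close>

definition sym_deriv :: "(heis_var \<Rightarrow> complex) \<Rightarrow> sym \<Rightarrow> sym" where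
  "sym_deriv d f = (\<Sum>M\<in>Poly_Mapping.keys f. \<Sum>v\<in>Poly_Mapping.keys M.
     Poly_Mapping.single (M - Poly_Mapping.single v 1)
       (Poly_Mapping.lookup f M * of_nat (Poly_Mapping.lookup M v) * d v))"

lemma sym_deriv_superset:
  assumes "finite A" "Poly_Mapping.keys f \<subseteq> A"
  shows "sym_deriv d f = (\<Sum>M\<in>A. \<Sum>v\<in>Poly_Mapping.keys M.
     Poly_Mapping.single (M - Poly_Mapping.single v 1)
       (Poly_Mapping.lookup f M * of_nat (Poly_Mapping.lookup M v) * d v))"
  unfolding sym_deriv_def using assms
  by (intro sum.mono_neutral_left) (auto simp: in_keys_iff)

lemma sym_deriv_add: "sym_deriv d (f + g) = sym_deriv d f + sym_deriv d g"
proof -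
  let ?A = "Poly_Mapping.keys f \<union> Poly_Mapping.keys g"
  have "Poly_Mapping.keys (f + g) \<subseteq> ?A" by (rule Poly_Mapping.keys_add)
  then show ?thesis
    by (simp add: sym_deriv_superset[of ?A] lookup_add algebra_simps single_add sum.distrib)
qed

lemma sym_deriv_var: "sym_deriv d (sym_var v) = Poly_Mapping.single 0 (d v)"
  by (simp add: sym_deriv_def sym_var_def)

lemma sym_deriv_single:
  assumes "finite A" "Poly_Mapping.keys M \<subseteq> A"
  shows "sym_deriv d (Poly_Mapping.single M c) = (\<Sum>v\<in>A.
     Poly_Mapping.single (M - Poly_Mapping.single v 1) (c * of_nat (Poly_Mapping.lookup M v) * d v))"
proof -
  have "sym_deriv d (Poly_Mapping.single M c) = (\<Sum>v\<in>Poly_Mapping.keys M.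
     Poly_Mapping.single (M - Poly_Mapping.single v 1) (c * of_nat (Poly_Mapping.lookup M v) * d v))"
    by (simp add: sym_deriv_superset[of "{M}"])
  also have "\<dots> = (\<Sum>v\<in>A.
     Poly_Mapping.single (M - Poly_Mapping.single v 1) (c * of_nat (Poly_Mapping.lookup M v) * d v))"
    using assms by (intro sum.mono_neutral_left) (auto simp: in_keys_iff)
  finally show ?thesis .
qed

lemma monom_shift:
  fixes M N :: "heis_var \<Rightarrow>\<^sub>0 nat"
  shows "Poly_Mapping.single (M + N - Poly_Mapping.single v 1) (c * of_nat (Poly_Mapping.lookup M v))
    = Poly_Mapping.single (M - Poly_Mapping.single v 1 + N) (c * of_nat (Poly_Mapping.lookup M v) :: complex)"
proof (cases "Poly_Mapping.lookup M v = 0")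
  case False
  then have "M + N - Poly_Mapping.single v 1 = M - Poly_Mapping.single v 1 + N"
    by (intro poly_mapping_eqI) (auto simp: lookup_add lookup_minus lookup_single when_def)
  then show ?thesis by simp
qed simp

lemma sym_deriv_mult_single:
  "sym_deriv d (Poly_Mapping.single M c * Poly_Mapping.single N e) =
   sym_deriv d (Poly_Mapping.single M c) * Poly_Mapping.single N e +
   Poly_Mapping.single M c * sym_deriv d (Poly_Mapping.single N e)"
proof -
  let ?A = "Poly_Mapping.keys M \<union> Poly_Mapping.keys N"
  have k: "Poly_Mapping.keys (M + N) \<subseteq> ?A" by (rule Poly_Mapping.keys_add)
  have t: "Poly_Mapping.single (M + N - Poly_Mapping.single v 1)
        (c * e * of_nat (Poly_Mapping.lookup (M + N) v) * d v) =
      Poly_Mapping.single (M - Poly_Mapping.single v 1) (c * of_nat (Poly_Mapping.lookup M v) * d v)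
        * Poly_Mapping.single N e +
      Poly_Mapping.single M c *
        Poly_Mapping.single (N - Poly_Mapping.single v 1) (e * of_nat (Poly_Mapping.lookup N v) * d v)"
    for v
    using monom_shift[of M N v "c * e * d v"] monom_shift[of N M v "c * e * d v"]
    by (simp add: mult_single lookup_add algebra_simps single_add)
  show ?thesis
    by (simp only: mult_single sym_deriv_single[of ?A] k finite_Un Poly_Mapping.finite_keys
        Un_upper1 Un_upper2 t sum.distrib sum_distrib_left sum_distrib_right simp_thms)
qed

lemma poly_mapping_add_induct:
  assumes "P 0" "\<And>M c. P (Poly_Mapping.single M (c::complex))" "\<And>f g. P f \<Longrightarrow> P g \<Longrightarrow> P (f + g)"
  shows "P f"
  using assms
proof (induction f rule: update_induct)
  case const
  show ?case by (rule assms(1))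
next
  case (update f a b)
  have "Poly_Mapping.update a b f = f + Poly_Mapping.single a b"
    using update(1) by (intro poly_mapping_eqI) (auto simp: lookup_update lookup_add lookup_single in_keys_iff)
  with update assms show ?case by simp
qed

lemma sym_deriv_mult: "sym_deriv d (f * g) = sym_deriv d f * g + f * sym_deriv d g"
proof (induction f rule: poly_mapping_add_induct)
  case (2 M c)
  show ?case
    by (induction g rule: poly_mapping_add_induct)
      (simp_all add: sym_deriv_mult_single sym_deriv_add algebra_simps, simp add: sym_deriv_def)
qed (simp_all add: sym_deriv_add algebra_simps, simp add: sym_deriv_def)

definition heis_create :: "cartan_vec \<Rightarrow> nat \<Rightarrow> sym \<Rightarrow> sym" where
  "heis_create h m f = sym_elem h m * f"

definition heis_annih :: "cartan_vec \<Rightarrow> nat \<Rightarrow> sym \<Rightarrow> sym" where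
  "heis_annih h m = sym_deriv (\<lambda>(i, k).
     if k = m then of_nat m * cartan_form h (to_cartan (simple_root i)) else 0)"


section \<open>The coefficients of the vertex operators\<close>

text \<open>
  For operators \<open>a 1, a 2, \<dots>\<close>, \<open>op_pow a k m\<close> is the coefficient of \<open>x\<^sup>m\<close> in
  \<open>(\<Sum>\<^sub>j\<^sub>\<ge>\<^sub>1 a j x\<^sup>j)\<^sup>k\<close> and \<open>op_exp a m\<close> is its coefficient in
  \<open>exp (\<Sum>\<^sub>j\<^sub>\<ge>\<^sub>1 a j x\<^sup>j)\<close>. The series in the exponent has no constant term, so only
  the powers with \<open>k \<le> m\<close> contribute.
\<close>

fun op_pow :: "(nat \<Rightarrow> sym \<Rightarrow> sym) \<Rightarrow> nat \<Rightarrow> nat \<Rightarrow> sym \<Rightarrow> sym" where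
  "op_pow a 0 m f = (if m = 0 then f else 0)"
| "op_pow a (Suc k) m f = (\<Sum>j=1..m. a j (op_pow a k (m - j) f))"

definition op_exp :: "(nat \<Rightarrow> sym \<Rightarrow> sym) \<Rightarrow> nat \<Rightarrow> sym \<Rightarrow> sym" where
  "op_exp a m f = (\<Sum>k\<le>m. sym_scale (1 / fact k) (op_pow a k m f))"

text \<open>For \<open>r\<close> the formal variable is \<open>x\<^sup>-\<^sup>1\<close>.\<close>

definition sym_s :: "lat \<Rightarrow> nat \<Rightarrow> sym \<Rightarrow> sym" where
  "sym_s \<alpha> = op_exp (\<lambda>m f. sym_scale (1 / of_nat m) (heis_create (to_cartan \<alpha>) m f))"

definition sym_r :: "lat \<Rightarrow> nat \<Rightarrow> sym \<Rightarrow> sym" where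
  "sym_r \<alpha> = op_exp (\<lambda>m f. sym_scale (- 1 / of_nat m) (heis_annih (to_cartan \<alpha>) m f))"


section \<open>The lattice vertex algebra and its integral form\<close>

text \<open>
  \<open>V\<^sub>L\<close> is the free module over the symmetric algebra on the basis \<open>\<iota>(e\<^sub>\<alpha>)\<close>; the operators
  act on the coefficients. The type accommodates all ranks at once: \<open>V\<^sub>L\<close> for rank \<open>n\<close> consists of
  the elements that involve only \<open>\<alpha> \<in> root_lattice n\<close> and variables \<open>(i, m)\<close> with
  \<open>1 \<le> i \<le> n\<close> and \<open>m \<ge> 1\<close>. The product of the type \<^typ>\<open>'a \<Rightarrow>\<^sub>0 'b\<close> plays no role here.
\<close>

type_synonym latVA = "lat \<Rightarrow>\<^sub>0 sym"

definition iota :: "lat \<Rightarrow> latVA" where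
  "iota \<alpha> = Poly_Mapping.single \<alpha> 1"

definition s_op :: "lat \<Rightarrow> nat \<Rightarrow> latVA \<Rightarrow> latVA" where
  "s_op \<alpha> m = Poly_Mapping.map (sym_s \<alpha> m)"

definition r_op :: "lat \<Rightarrow> nat \<Rightarrow> latVA \<Rightarrow> latVA" where
  "r_op \<alpha> m = Poly_Mapping.map (sym_r \<alpha> m)"

definition V_int :: "nat \<Rightarrow> latVA set" where
  "V_int n = group_closure
     {foldr (\<lambda>(\<beta>, m). s_op \<beta> m) ks (iota \<alpha>) | ks \<alpha>.
        set ks \<subseteq> simple_roots n \<times> {1..} \<and> \<alpha> \<in> root_lattice n}"


section \<open>Extension of scalars\<close>

text \<open>
  For a subgroup \<open>M\<close> of an abelian group, the tensor product of \<open>M\<close> with the field \<open>'f\<close> over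
  the integers: the free abelian group on \<open>M \<times> 'f\<close> modulo the subgroup generated by the
  biadditivity relations. Its elements are the cosets of that subgroup.
\<close>

type_synonym ('a, 'f) tensor = "('a \<times> 'f \<Rightarrow>\<^sub>0 int) set"

definition tensor_rel :: "'a::ab_group_add set \<Rightarrow> ('a \<times> 'f::field \<Rightarrow>\<^sub>0 int) set" where
  "tensor_rel M = group_closure
     ({frag_of (u + v, c) - frag_of (u, c) - frag_of (v, c) | u v c. u \<in> M \<and> v \<in> M} \<union>
      {frag_of (u, c + d) - frag_of (u, c) - frag_of (u, d) | u c d. u \<in> M})"

definition tensor_class ::
    "'a::ab_group_add set \<Rightarrow> ('a \<times> 'f::field \<Rightarrow>\<^sub>0 int) \<Rightarrow> ('a, 'f) tensor" where
  "tensor_class M x = {y. y - x \<in> tensor_rel M}"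

definition tensor_space :: "'a::ab_group_add set \<Rightarrow> ('a, 'f::field) tensor set" where
  "tensor_space M = tensor_class M ` {x. Poly_Mapping.keys x \<subseteq> M \<times> UNIV}"

definition pure_tensor :: "'a::ab_group_add set \<Rightarrow> 'a \<Rightarrow> 'f::field \<Rightarrow> ('a, 'f) tensor" where
  "pure_tensor M u c = tensor_class M (frag_of (u, c))"

definition tensor_add ::
    "'a::ab_group_add set \<Rightarrow> ('a, 'f::field) tensor \<Rightarrow> ('a, 'f) tensor \<Rightarrow> ('a, 'f) tensor" where
  "tensor_add M X Y = (\<Union>x\<in>X. \<Union>y\<in>Y. tensor_class M (x + y))"

definition tensor_scale ::
    "'a::ab_group_add set \<Rightarrow> 'f::field \<Rightarrow> ('a, 'f) tensor \<Rightarrow> ('a, 'f) tensor" where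
  "tensor_scale M c X =
     (\<Union>x\<in>X. tensor_class M (frag_extend (\<lambda>(u, d). frag_of (u, c * d)) x))"

text \<open>The map \<open>T \<otimes> id\<close> induced by an additive map \<open>T\<close> that preserves \<open>M\<close>.\<close>

definition tensor_map ::
    "'a::ab_group_add set \<Rightarrow> ('a \<Rightarrow> 'a) \<Rightarrow> ('a, 'f::field) tensor \<Rightarrow> ('a, 'f) tensor" where
  "tensor_map M T X =
     (\<Union>x\<in>X. tensor_class M (frag_extend (\<lambda>(u, d). frag_of (T u, d)) x))"

definition tensor_subspace ::
    "'a::ab_group_add set \<Rightarrow> ('a, 'f::field) tensor set \<Rightarrow> bool" where
  "tensor_subspace M W \<longleftrightarrow> W \<subseteq> tensor_space M \<and> tensor_class M 0 \<in> W \<and>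
     (\<forall>X\<in>W. \<forall>Y\<in>W. tensor_add M X Y \<in> W) \<and> (\<forall>c. \<forall>X\<in>W. tensor_scale M c X \<in> W)"

definition tensor_bilinear ::
    "'a::ab_group_add set \<Rightarrow> (('a, 'f::field) tensor \<Rightarrow> ('a, 'f) tensor \<Rightarrow> 'f) \<Rightarrow> bool" where
  "tensor_bilinear M B \<longleftrightarrow>
     (\<forall>X\<in>tensor_space M. \<forall>Y\<in>tensor_space M. \<forall>Z\<in>tensor_space M.
        B (tensor_add M X Y) Z = B X Z + B Y Z \<and> B Z (tensor_add M X Y) = B Z X + B Z Y) \<and>
     (\<forall>c. \<forall>X\<in>tensor_space M. \<forall>Y\<in>tensor_space M.
        B (tensor_scale M c X) Y = c * B X Y \<and> B X (tensor_scale M c Y) = c * B X Y)"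


section \<open>The vertex algebra over a field, its form and the subspace \<open>I\<^sub>L\<close>\<close>

type_synonym 'f mod_latVA = "(latVA, 'f) tensor"

definition V_mod :: "nat \<Rightarrow> 'f::field mod_latVA set" where
  "V_mod n = tensor_space (V_int n)"

definition iota_mod :: "nat \<Rightarrow> lat \<Rightarrow> 'f::field mod_latVA" where
  "iota_mod n \<alpha> = pure_tensor (V_int n) (iota \<alpha>) 1"

definition s_mod :: "nat \<Rightarrow> lat \<Rightarrow> nat \<Rightarrow> 'f::field mod_latVA \<Rightarrow> 'f mod_latVA" where
  "s_mod n \<alpha> m = tensor_map (V_int n) (s_op \<alpha> m)"

definition r_mod :: "nat \<Rightarrow> lat \<Rightarrow> nat \<Rightarrow> 'f::field mod_latVA \<Rightarrow> 'f mod_latVA" where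
  "r_mod n \<alpha> m = tensor_map (V_int n) (r_op \<alpha> m)"

text \<open>
  The conditions that determine the form. Only the values of \<open>B\<close> on \<open>V_mod n\<close> are meaningful.
\<close>

definition is_V_form :: "nat \<Rightarrow> ('f::field mod_latVA \<Rightarrow> 'f mod_latVA \<Rightarrow> 'f) \<Rightarrow> bool" where
  "is_V_form n B \<longleftrightarrow>
     tensor_bilinear (V_int n) B \<and>
     (\<forall>u\<in>V_mod n. \<forall>v\<in>V_mod n. B u v = B v u) \<and>
     (\<forall>\<alpha>\<in>root_lattice n. \<forall>\<beta>\<in>root_lattice n.
        B (iota_mod n \<alpha>) (iota_mod n \<beta>) = (if \<alpha> = - \<beta> then 1 else 0)) \<and>
     (\<forall>\<alpha>\<in>root_lattice n. \<forall>m. \<forall>u\<in>V_mod n. \<forall>v\<in>V_mod n.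
        B (s_mod n \<alpha> m u) v = B u (r_mod n \<alpha> m v))"

definition V_radical ::
    "nat \<Rightarrow> ('f::field mod_latVA \<Rightarrow> 'f mod_latVA \<Rightarrow> 'f) \<Rightarrow> 'f mod_latVA set" where
  "V_radical n B = {v \<in> V_mod n. \<forall>u\<in>V_mod n. B v u = 0}"

text \<open>The linear span in \<^term>\<open>V_mod n\<close> of the given generators, with \<open>q = p\<^sup>r\<close>.\<close>

definition I_L :: "nat \<Rightarrow> nat \<Rightarrow> 'f::field mod_latVA set" where
  "I_L n q = tensor_subspace (V_int n) hull
     {foldr (\<lambda>(\<beta>, k). s_mod n \<beta> k) ks (s_mod n (eta n) m (iota_mod n \<alpha>)) | ks m \<alpha>.
        set ks \<subseteq> simple_roots n \<times> {1..} \<and> m \<ge> 1 \<and> \<not> q dvd m \<and> \<alpha> \<in> root_lattice n}"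

end

theory Submission
  imports Defs
begin

text \<open>
  The operators satisfy
  \<open>E\<^sup>+(-\<alpha>, x) E\<^sup>-(-\<beta>, y) = (1 - y/x)\<^bsup>\<langle>\<alpha>, \<beta>\<rangle>\<^esup> E\<^sup>-(-\<beta>, y) E\<^sup>+(-\<alpha>, x)\<close>.
  The vector \<open>\<eta>\<close> is orthogonal to every simple root but the last, with which it pairs to
  \<open>n + 1 = a p\<^sup>r\<close>, and \<open>(1 - z)\<^bsup>a q\<^esup> \<equiv> (1 - z\<^bsup>q\<^esup>)\<^bsup>a\<^esup>\<close> modulo \<open>p\<close> for \<open>q = p\<^sup>r\<close>. Moving
  \<open>r\<^bsub>\<eta>,m\<^esub>\<close> with \<open>q \<nmid> m\<close> to the right through the \<open>s\<^bsub>\<beta>,k\<^esub>\<close> of a basis element therefore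
  produces, modulo \<open>p\<close>, only terms with \<open>r\<^bsub>\<eta>,m'\<^esub>\<close> where \<open>q \<nmid> m'\<close>; as \<open>m' > 0\<close>, these
  annihilate \<open>\<iota>(e\<^sub>\<gamma>)\<close>. So \<open>r\<^bsub>\<eta>,m\<^esub>\<close> acts as zero on the reduction modulo \<open>p\<close>, and the
  adjointness of \<open>s\<close> and \<open>r\<close> gives the claim.
\<close>

subsection \<open>Exponentials of commuting operators\<close>

lemma sym_scale_eq: "sym_scale c f = Poly_Mapping.single 0 c * f"
  by (simp add: sym_scale_def mult_map_scale_conv_mult)

lemma sym_const_mult: "Poly_Mapping.single 0 (a::complex) * (Poly_Mapping.single 0 b * f) = Poly_Mapping.single 0 (a * b) * (f::sym)"
  by (simp add: mult.assoc[symmetric] mult_single)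

lemma sum_triangle_swap:
  fixes g :: "nat \<Rightarrow> nat \<Rightarrow> 'a::comm_monoid_add"
  shows "(\<Sum>i=1..m. \<Sum>j=1..m-i. g i j) = (\<Sum>j=1..m. \<Sum>i=1..m-j. g i j)"
  unfolding sum.Sigma[OF finite_atLeastAtMost ballI[OF finite_atLeastAtMost]]
  by (rule sum.reindex_bij_witness[of _ prod.swap prod.swap]) auto

text \<open>Each of the k factors raises the degree by at least one.\<close>

lemma op_pow_gt:
  assumes "\<And>j. a j 0 = 0" "k > m"
  shows "op_pow a k m f = 0"
  using assms(2)
proof (induction k arbitrary: m)
  case (Suc k)
  then have "op_pow a k (m - j) f = 0" if "j \<in> {1..m}" for j using that by auto
  then show ?case by (simp add: assms(1))
qed simp

locale commuting_family =
  fixes a :: "nat \<Rightarrow> sym \<Rightarrow> sym"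
  assumes add: "a j (f + g) = a j f + a j g"
    and scale: "a j (Poly_Mapping.single 0 c * f) = Poly_Mapping.single 0 c * a j f"
    and commute: "a i (a j f) = a j (a i f)"
begin

lemma zero [simp]: "a j 0 = 0"
  using add[of j 0 0] by simp

lemma sum: "a j (\<Sum>x\<in>A. h x) = (\<Sum>x\<in>A. a j (h x))"
  by (induction A rule: infinite_finite_induct) (simp_all add: add)

lemma of_nat: "a j (of_nat k * f) = of_nat k * a j f"
  using scale[of j "of_nat k" f] by simp

text \<open>The coefficient of x^m in x (A^(k+1))' = (k+1) (x A') A^k. This rule holds for a series
  of operators because its coefficients commute.\<close>

lemma op_pow_deriv:
  "of_nat m * op_pow a (Suc k) m f =
     of_nat (Suc k) * (\<Sum>j=1..m. of_nat j * a j (op_pow a k (m - j) f))"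
proof (induction k arbitrary: m)
  case 0
  have *: "(\<Sum>j=1..m. g j (op_pow a 0 (m - j) f)) = (if m = 0 then 0 else g m f)"
    if "\<And>j. g j 0 = 0" for g :: "nat \<Rightarrow> sym \<Rightarrow> sym"
  proof (cases "m = 0")
    case False
    have "(\<Sum>j=1..m. g j (op_pow a 0 (m - j) f)) = (\<Sum>j=1..m. if j = m then g m f else 0)"
      by (rule sum.cong) (auto simp: that)
    then show ?thesis using False by (simp add: sum.delta)
  qed simp
  show ?case
    unfolding op_pow.simps(2) *[of a, OF zero] by (subst *[of "\<lambda>j f. of_nat j * a j f"]) auto
next
  case (Suc k)
  let ?P = "op_pow a"
  have "of_nat m * ?P (Suc (Suc k)) m f = (\<Sum>i=1..m. of_nat m * a i (?P (Suc k) (m - i) f))"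
    by (simp add: sum_distrib_left)
  \<comment> \<open>Leibniz rule: m = i + (m - i) splits the degree between the outermost factor and
    the remaining power.\<close>
  also have "\<dots> = (\<Sum>i=1..m. of_nat i * a i (?P (Suc k) (m - i) f)
       + a i (of_nat (m - i) * ?P (Suc k) (m - i) f))"
  proof (rule sum.cong[OF refl])
    fix i assume "i \<in> {1..m}"
    then have "m = i + (m - i)" by simp
    then have "(of_nat m :: sym) = of_nat i + of_nat (m - i)" by (metis of_nat_add)
    then show "of_nat m * a i (?P (Suc k) (m - i) f) = of_nat i * a i (?P (Suc k) (m - i) f)
       + a i (of_nat (m - i) * ?P (Suc k) (m - i) f)"
      by (simp only: of_nat distrib_right)
  qed
  also have "\<dots> = (\<Sum>i=1..m. of_nat i * a i (?P (Suc k) (m - i) f))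
      + (\<Sum>i=1..m. \<Sum>j=1..m-i. of_nat (Suc k) * (of_nat j * a j (a i (?P k (m - i - j) f))))"
    unfolding Suc.IH
    by (simp only: sum.distrib of_nat sum commute sum_distrib_left)
  \<comment> \<open>As \<open>a j\<close> now stands in front, exchanging the sums lets the sum over
    i rebuild \<open>op_pow a (Suc k)\<close>.\<close>
  also have "(\<Sum>i=1..m. \<Sum>j=1..m-i. of_nat (Suc k) * (of_nat j * a j (a i (?P k (m - i - j) f))))
     = (\<Sum>j=1..m. of_nat (Suc k) * (of_nat j * a j (?P (Suc k) (m - j) f)))"
    by (subst sum_triangle_swap) (simp only: op_pow.simps sum sum_distrib_left diff_commute)
  finally show ?case
    by (simp only: sum_distrib_left[symmetric] of_nat_Suc[of "Suc k"] distrib_right mult_1_left)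
qed

lemma op_exp_0: "op_exp a 0 f = f"
  by (simp add: op_exp_def sym_scale_eq)

text \<open>The equation x F' = (x A') F for F = exp A, obtained from \<open>op_pow_deriv\<close> by
  summing over k with weights 1/k!.\<close>

lemma op_exp_rec: "of_nat m * op_exp a m f = (\<Sum>j=1..m. of_nat j * a j (op_exp a (m - j) f))"
proof (cases m)
  case (Suc m')
  let ?c = "\<lambda>k. Poly_Mapping.single 0 (1 / fact k :: complex) :: sym"
  have c: "?c (Suc k) * (of_nat (Suc k) * x) = ?c k * x" for k x
  proof -
    have "1 / fact (Suc k) * of_nat (Suc k) = (1 / fact k :: complex)"
      by (simp add: field_simps del: of_nat_Suc)
    then show ?thesis
      using sym_const_mult[of "1 / fact (Suc k)" "of_nat (Suc k)" x] by (simp only: single_of_nat)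
  qed
  have "of_nat m * op_exp a m f = (\<Sum>k\<le>m. ?c k * (of_nat m * op_pow a k m f))"
    by (simp only: op_exp_def sym_scale_eq sum_distrib_left mult.left_commute)
  also have "\<dots> = (\<Sum>k\<le>m'. ?c (Suc k) * (of_nat m * op_pow a (Suc k) m f))"
    unfolding Suc sum.atMost_Suc_shift by (simp del: op_pow.simps(2) of_nat_Suc fact_Suc)
  also have "\<dots> = (\<Sum>k\<le>m'. ?c k * (\<Sum>j=1..m. of_nat j * a j (op_pow a k (m - j) f)))"
    unfolding op_pow_deriv c ..
  also have "\<dots> = (\<Sum>k\<le>m'. \<Sum>j=1..m. of_nat j * a j (?c k * op_pow a k (m - j) f))"
    by (simp only: sum_distrib_left scale mult.left_commute)
  also have "\<dots> = (\<Sum>j=1..m. of_nat j * a j (\<Sum>k\<le>m'. ?c k * op_pow a k (m - j) f))"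
    by (simp only: sum_distrib_left sum) (rule sum.swap)
  also have "\<dots> = (\<Sum>j=1..m. of_nat j * a j (op_exp a (m - j) f))"
  proof (rule sum.cong[OF refl])
    fix j assume "j \<in> {1..m}"
    \<comment> \<open>The exponential at m - j stops at k = m - j; the surplus powers up to m' have
      too many factors for their degree and vanish.\<close>
    then have "m - j \<le> m'" using Suc by auto
    moreover have "op_pow a k (m - j) f = 0" if "k > m - j" for k
      by (rule op_pow_gt[of a, OF zero that])
    ultimately have "(\<Sum>k\<le>m'. ?c k * op_pow a k (m - j) f) = (\<Sum>k\<le>m-j. ?c k * op_pow a k (m - j) f)"
      by (intro sum.mono_neutral_right) auto
    then show "of_nat j * a j (\<Sum>k\<le>m'. ?c k * op_pow a k (m - j) f) = of_nat j * a j (op_exp a (m - j) f)"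
      by (simp add: op_exp_def sym_scale_eq)
  qed
  finally show ?thesis .
qed simp

end

section \<open>Uniqueness and products of exponential series\<close>

lemma sym_of_nat_cancel:
  assumes "of_nat m * x = of_nat m * (y::sym)" "m > 0"
  shows "x = y"
proof -
  have *: "Poly_Mapping.single 0 (1 / of_nat m) * (of_nat m * z) = z" for z :: sym
    using sym_const_mult[of "1 / of_nat m" "of_nat m" z] assms(2) by simp
  show ?thesis
    using *[of x] unfolding assms(1) * by (rule sym)
qed

text \<open>
  The coefficient form of \<open>x F'(x) = b(x) F(x)\<close> with \<open>b(x) = \<Sum>\<^sub>j\<^sub>\<ge>\<^sub>1 b\<^sub>j x\<^sup>j\<close>, which
  characterises the exponential of \<open>\<Sum>\<^sub>j\<^sub>\<ge>\<^sub>1 b\<^sub>j x\<^sup>j / j\<close> up to its constant term.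
\<close>

definition exp_series :: "(nat \<Rightarrow> sym \<Rightarrow> sym) \<Rightarrow> (nat \<Rightarrow> sym) \<Rightarrow> bool" where
  "exp_series b F \<longleftrightarrow> (\<forall>m. of_nat m * F m = (\<Sum>j=1..m. b j (F (m - j))))"

text \<open>The sum starts at j = 1, so the equation expresses m F(m) through earlier values, and m
  is invertible over the complex numbers. Operator identities below are proved by checking the
  equation and the constant term on both sides.\<close>

lemma exp_series_unique:
  assumes "exp_series b F" "exp_series b G" "F 0 = G 0"
  shows "F m = G m"
proof (induction m rule: less_induct)
  case (less m)
  show ?case
  proof (cases "m = 0")
    case False
    have "(\<Sum>j=1..m. b j (F (m - j))) = (\<Sum>j=1..m. b j (G (m - j)))"
      using less by (intro sum.cong) auto
    then have "of_nat m * F m = of_nat m * G m"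
      using assms(1,2) by (simp only: exp_series_def)
    with False show ?thesis by (auto dest: sym_of_nat_cancel)
  qed (use assms in simp)
qed

text \<open>Leibniz rule for a product of series. It serves with \<open>e\<close> a derivation, for
  the multiplicativity of E^+, and with \<open>e\<close> multiplication by a sum, for E^- of a sum
  of lattice vectors.\<close>

lemma exp_series_conv:
  assumes F: "exp_series a F" and G: "exp_series b G"
    and prod: "\<And>j x y. e j (x * y) = a j x * y + x * b j y"
    and add: "\<And>j x y. e j (x + y) = e j x + e j y"
  shows "exp_series e (\<lambda>m. \<Sum>i\<le>m. F i * G (m - i))"
  unfolding exp_series_def
proof
  fix m
  have e0: "e j 0 = 0" for j using add[of j 0 0] by simp
  have esum: "e j (\<Sum>x\<in>A. h x) = (\<Sum>x\<in>A. e j (h x))" for j A and h :: "nat \<Rightarrow> sym"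
    by (induction A rule: infinite_finite_induct) (simp_all add: add e0)
  have "of_nat m * (\<Sum>i\<le>m. F i * G (m - i)) =
      (\<Sum>i\<le>m. (of_nat i * F i) * G (m - i) + F i * (of_nat (m - i) * G (m - i)))"
    unfolding sum_distrib_left
  proof (rule sum.cong[OF refl])
    fix i assume "i \<in> {..m}"
    then have "m = i + (m - i)" by simp
    then have "(of_nat m :: sym) = of_nat i + of_nat (m - i)" by (metis of_nat_add)
    then show "of_nat m * (F i * G (m - i)) = of_nat i * F i * G (m - i) + F i * (of_nat (m - i) * G (m - i))"
      by (simp only: distrib_left distrib_right ac_simps)
  qed
  also have "\<dots> = (\<Sum>i\<le>m. \<Sum>j=1..i. a j (F (i - j)) * G (m - i))
      + (\<Sum>i\<le>m. \<Sum>j=1..m-i. F i * b j (G (m - i - j)))"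
    using F G unfolding exp_series_def by (simp only: sum.distrib sum_distrib_left sum_distrib_right)
  \<comment> \<open>Both double sums are reindexed with j outermost, so that the inner sums combine
    to the convolution at m - j.\<close>
  also have "(\<Sum>i\<le>m. \<Sum>j=1..i. a j (F (i - j)) * G (m - i)) = (\<Sum>j=1..m. \<Sum>i\<le>m-j. a j (F i) * G (m - j - i))"
    unfolding sum.Sigma[OF finite_atLeastAtMost ballI[OF finite_atMost]] sum.Sigma[OF finite_atMost ballI[OF finite_atLeastAtMost]]
    by (rule sum.reindex_bij_witness[of _ "\<lambda>(j, i). (i + j, j)" "\<lambda>(i, j). (j, i - j)"]) auto
  also have "(\<Sum>i\<le>m. \<Sum>j=1..m-i. F i * b j (G (m - i - j))) = (\<Sum>j=1..m. \<Sum>i\<le>m-j. F i * b j (G (m - j - i)))"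
    unfolding sum.Sigma[OF finite_atLeastAtMost ballI[OF finite_atMost]] sum.Sigma[OF finite_atMost ballI[OF finite_atLeastAtMost]]
    by (rule sum.reindex_bij_witness[of _ prod.swap prod.swap]) (auto simp: add.commute)
  finally show "of_nat m * (\<Sum>i\<le>m. F i * G (m - i)) = (\<Sum>j=1..m. e j (\<Sum>i\<le>m-j. F i * G (m - j - i)))"
    by (simp only: esum prod sum.distrib)
qed

subsection \<open>The operators on the symmetric algebra\<close>

lemma sym_deriv_const: "sym_deriv d (Poly_Mapping.single 0 c) = 0"
  by (simp add: sym_deriv_def)

lemma sym_deriv_0: "sym_deriv d 0 = 0"
  by (simp add: sym_deriv_def)

lemma sym_deriv_scale: "sym_deriv d (Poly_Mapping.single 0 c * f) = Poly_Mapping.single 0 c * sym_deriv d f"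
  by (simp add: sym_deriv_mult sym_deriv_const)

text \<open>The commutator of two derivations is a derivation, and here it kills every variable
  since derivatives of variables are constants. Monomials are built up one variable factor at a
  time.\<close>

lemma sym_deriv_commute: "sym_deriv d (sym_deriv e f) = sym_deriv e (sym_deriv d f)"
proof (induction f rule: poly_mapping_add_induct)
  case (2 M c)
  have "\<forall>c. sym_deriv d (sym_deriv e (Poly_Mapping.single M c)) = sym_deriv e (sym_deriv d (Poly_Mapping.single M c))"
  proof (induction M rule: update_induct)
    case const
    show ?case by (simp add: sym_deriv_const sym_deriv_0)
  next
    case (update M v k)
    have eq: "Poly_Mapping.update v k M = M + Poly_Mapping.single v k"
      using update(1)
      by (intro poly_mapping_eqI) (auto simp: lookup_update lookup_add lookup_single in_keys_iff)
    have "\<forall>c. sym_deriv d (sym_deriv e (Poly_Mapping.single (M + Poly_Mapping.single v k) c))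
       = sym_deriv e (sym_deriv d (Poly_Mapping.single (M + Poly_Mapping.single v k) c))"
    proof (induction k)
      case 0
      show ?case using update by simp
    next
      case (Suc k)
      have "Poly_Mapping.single (M + Poly_Mapping.single v (Suc k)) c
          = Poly_Mapping.single (M + Poly_Mapping.single v k) c * sym_var v" for c
        by (simp add: sym_var_def mult_single add.assoc single_add[symmetric])
      then show ?case
        using Suc by (simp add: sym_deriv_mult sym_deriv_add sym_deriv_var sym_deriv_const)
    qed
    then show ?case unfolding eq .
  qed
  then show ?case by blast
qed (simp_all add: sym_deriv_add sym_deriv_0)

lemma family_s: "commuting_family (\<lambda>m f. sym_scale (1 / of_nat m) (heis_create h m f))"
  by unfold_locales (simp_all add: sym_scale_eq heis_create_def distrib_left mult_ac)

lemma family_r: "commuting_family (\<lambda>m f. sym_scale (- 1 / of_nat m) (heis_annih h m f))"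
proof
  fix i j f
  show "sym_scale (- 1 / of_nat i) (heis_annih h i (sym_scale (- 1 / of_nat j) (heis_annih h j f))) =
       sym_scale (- 1 / of_nat j) (heis_annih h j (sym_scale (- 1 / of_nat i) (heis_annih h i f)))"
    unfolding sym_scale_eq heis_annih_def sym_deriv_scale
    by (subst sym_deriv_commute) (simp only: mult_ac)
qed (simp_all only: sym_scale_eq heis_annih_def sym_deriv_add sym_deriv_scale distrib_left mult.left_commute)

lemma sym_s_0: "sym_s \<alpha> 0 f = f"
  unfolding sym_s_def by (rule commuting_family.op_exp_0[OF family_s])

lemma sym_r_0: "sym_r \<alpha> 0 f = f"
  unfolding sym_r_def by (rule commuting_family.op_exp_0[OF family_r])

text \<open>Differentiation cancels the 1/j in the exponent of E^-; the same happens for E^+ in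
  \<open>exp_series_r\<close>.\<close>

lemma exp_series_s: "exp_series (\<lambda>j. (*) (sym_elem (to_cartan \<alpha>) j)) (\<lambda>m. sym_s \<alpha> m f)"
  unfolding exp_series_def
proof
  fix m
  have *: "of_nat j * sym_scale (1 / of_nat j) (heis_create h j g) = sym_elem h j * g" if "j \<in> {1..m}" for j h g
    using that sym_const_mult[of "of_nat j" "1 / of_nat j" "sym_elem h j * g"]
    by (simp add: sym_scale_eq heis_create_def)
  show "of_nat m * sym_s \<alpha> m f = (\<Sum>j=1..m. sym_elem (to_cartan \<alpha>) j * sym_s \<alpha> (m - j) f)"
    using commuting_family.op_exp_rec[OF family_s, of m "to_cartan \<alpha>" f, folded sym_s_def]
    by (simp only: *  cong: sum.cong)
qed

lemma exp_series_r: "exp_series (\<lambda>j f. - heis_annih (to_cartan \<alpha>) j f) (\<lambda>m. sym_r \<alpha> m f)"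
  unfolding exp_series_def
proof
  fix m
  have *: "of_nat j * sym_scale (- 1 / of_nat j) g = - g" if "j \<in> {1..m}" for j g
    using that sym_const_mult[of "of_nat j" "- 1 / of_nat j" g]
    by (simp add: sym_scale_eq single_uminus)
  show "of_nat m * sym_r \<alpha> m f = (\<Sum>j=1..m. - heis_annih (to_cartan \<alpha>) j (sym_r \<alpha> (m - j) f))"
    using commuting_family.op_exp_rec[OF family_r, of m "to_cartan \<alpha>" f, folded sym_r_def]
    by (simp only: *  cong: sum.cong)
qed

lemma exp_series_add:
  assumes "exp_series b F" "exp_series b G" "\<And>j x y. b j (x + y) = b j x + b j y"
  shows "exp_series b (\<lambda>m. F m + G m)"
  using assms by (simp add: exp_series_def distrib_left sum.distrib)

lemma heis_annih_add: "heis_annih h j (f + g) = heis_annih h j f + heis_annih h j g"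
  by (simp add: heis_annih_def sym_deriv_add)

lemma heis_annih_mult: "heis_annih h j (f * g) = heis_annih h j f * g + f * heis_annih h j g"
  by (simp add: heis_annih_def sym_deriv_mult)

lemma sym_s_add: "sym_s \<alpha> m (f + g) = sym_s \<alpha> m f + sym_s \<alpha> m g"
  by (rule exp_series_unique[OF exp_series_s exp_series_add[OF exp_series_s exp_series_s]])
    (simp_all add: sym_s_0 distrib_left)

text \<open>The equation is preserved under multiplication by f. Knowing s as a multiplication
  operator reduces its commutation with r to the value at 1.\<close>

lemma sym_s_mult: "sym_s \<alpha> m f = sym_s \<alpha> m 1 * f"
proof (rule exp_series_unique[OF exp_series_s])
  show "exp_series (\<lambda>j. (*) (sym_elem (to_cartan \<alpha>) j)) (\<lambda>m. sym_s \<alpha> m 1 * f)"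
    using exp_series_s[of \<alpha> 1] unfolding exp_series_def
    by (simp add: mult.assoc[symmetric] sum_distrib_right)
qed (simp add: sym_s_0)

lemma sym_r_add: "sym_r \<alpha> m (f + g) = sym_r \<alpha> m f + sym_r \<alpha> m g"
  by (rule exp_series_unique[OF exp_series_r exp_series_add[OF exp_series_r exp_series_r]])
    (simp_all add: sym_r_0 heis_annih_add)

text \<open>As the exponential of a derivation, \<open>E\<^sup>+(-\<alpha>, x)\<close> is multiplicative.\<close>

lemma sym_r_mult: "sym_r \<alpha> m (f * g) = (\<Sum>i\<le>m. sym_r \<alpha> i f * sym_r \<alpha> (m - i) g)"
  by (rule exp_series_unique[OF exp_series_r exp_series_conv[OF exp_series_r exp_series_r]])
    (simp_all add: sym_r_0 heis_annih_add heis_annih_mult algebra_simps)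

section \<open>Dependence of E^- on the lattice vector\<close>

lemma lookup_to_cartan: "Poly_Mapping.lookup (to_cartan \<alpha>) i = of_int (Poly_Mapping.lookup \<alpha> i)"
  by (simp add: to_cartan_def map.rep_eq when_def)

lemma to_cartan_add: "to_cartan (\<alpha> + \<beta>) = to_cartan \<alpha> + to_cartan \<beta>"
  by (rule poly_mapping_eqI) (simp add: lookup_to_cartan lookup_add)

lemma sym_elem_superset:
  assumes "finite A" "Poly_Mapping.keys h \<subseteq> A"
  shows "sym_elem h m = (\<Sum>i\<in>A. Poly_Mapping.single 0 (Poly_Mapping.lookup h i) * sym_var (i, m))"
  unfolding sym_elem_def sym_scale_eq using assms
  by (intro sum.mono_neutral_left) (auto simp: in_keys_iff)

lemma sym_elem_add: "sym_elem (h + h') m = sym_elem h m + sym_elem h' m"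
proof -
  let ?A = "Poly_Mapping.keys h \<union> Poly_Mapping.keys h'"
  have "Poly_Mapping.keys (h + h') \<subseteq> ?A" by (rule Poly_Mapping.keys_add)
  then show ?thesis
    by (simp add: sym_elem_superset[of ?A] lookup_add single_add distrib_right sum.distrib)
qed

text \<open>E^- turns sums of lattice vectors into products; this reaches s for eta from s for the
  simple roots.\<close>

lemma sym_s_plus: "sym_s (\<alpha> + \<beta>) m f = (\<Sum>i\<le>m. sym_s \<alpha> i (sym_s \<beta> (m - i) f))"
proof -
  have "sym_s (\<alpha> + \<beta>) m f = (\<Sum>i\<le>m. sym_s \<alpha> i 1 * sym_s \<beta> (m - i) f)"
    by (rule exp_series_unique[OF exp_series_s exp_series_conv[OF exp_series_s exp_series_s]])
      (simp_all add: sym_s_0 to_cartan_add sym_elem_add algebra_simps)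
  then show ?thesis by (simp only: sym_s_mult[of \<alpha> _ "sym_s \<beta> _ f"])
qed

section \<open>Commutation of r with s for simple roots\<close>

lemma to_cartan_simple: "to_cartan (simple_root i) = Poly_Mapping.single i 1"
  by (simp add: to_cartan_def simple_root_def)

lemma sym_elem_simple: "sym_elem (to_cartan (simple_root i)) m = sym_var (i, m)"
  by (simp add: to_cartan_simple sym_elem_def sym_scale_eq)

text \<open>Kept in \<open>int\<close>, unlike \<open>cartan_form\<close>, so that the commutation
  coefficients built from it are integers.\<close>

definition simple_pairing :: "lat \<Rightarrow> nat \<Rightarrow> int" where
  "simple_pairing \<alpha> i = (\<Sum>j\<in>Poly_Mapping.keys \<alpha>. Poly_Mapping.lookup \<alpha> j * cartan_A j i)"

lemma cartan_form_simple:
  "cartan_form (to_cartan \<alpha>) (to_cartan (simple_root i)) = of_int (simple_pairing \<alpha> i)"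
proof -
  have "Poly_Mapping.keys (to_cartan \<alpha>) = Poly_Mapping.keys \<alpha>"
    by (auto simp: to_cartan_def in_keys_iff map.rep_eq when_def)
  then show ?thesis
    unfolding cartan_form_def simple_pairing_def of_int_sum to_cartan_simple
    by (auto simp: to_cartan_def map.rep_eq when_def intro!: sum.cong)
qed

lemma heis_annih_var:
  "heis_annih (to_cartan \<alpha>) j (sym_var (i, k)) = (if k = j then of_nat j * of_int (simple_pairing \<alpha> i) else 0)"
  using mult_single[of "0 :: heis_var \<Rightarrow>\<^sub>0 nat" "of_nat j" 0 "of_int (simple_pairing \<alpha> i) :: complex"]
  by (simp add: heis_annih_def sym_deriv_var cartan_form_simple)

text \<open>On generating functions, \<alpha>(j) multiplies E^- of a simple root by the pairing
  times x^j. The induction differentiates the recursion for the coefficients.\<close>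

lemma heis_annih_s:
  assumes "j \<ge> 1"
  shows "heis_annih (to_cartan \<alpha>) j (sym_s (simple_root i) k 1) =
     (if j \<le> k then of_int (simple_pairing \<alpha> i) * sym_s (simple_root i) (k - j) 1 else 0)"
proof (induction k rule: less_induct)
  case (less k)
  let ?S = "\<lambda>k. sym_s (simple_root i) k 1"
  let ?D = "heis_annih (to_cartan \<alpha>) j"
  let ?N = "of_int (simple_pairing \<alpha> i) :: sym"
  have D0: "?D 0 = 0" using heis_annih_add[of _ _ 0 0] by simp
  have Dsum: "?D (\<Sum>x\<in>A. h x) = (\<Sum>x\<in>A. ?D (h x))" for A and h :: "nat \<Rightarrow> sym"
    by (induction A rule: infinite_finite_induct) (simp_all add: heis_annih_add D0)
  have Dnat: "?D (of_nat l * f) = of_nat l * ?D f" for l f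
    using sym_deriv_scale[of _ "of_nat l" f] by (simp add: heis_annih_def)
  have S: "of_nat k * ?S k = (\<Sum>l=1..k. sym_var (i, l) * ?S (k - l))" for k
    using exp_series_s[of "simple_root i" 1] unfolding exp_series_def sym_elem_simple by blast
  have one: "?D 1 = 0" using sym_deriv_const[of _ 1] by (simp add: heis_annih_def)
  show ?case
  proof (cases "k = 0")
    case True
    then show ?thesis using assms by (simp add: sym_s_0 one)
  next
    case False
    have "of_nat k * ?D (?S k) = (\<Sum>l=1..k. ?D (sym_var (i, l)) * ?S (k - l))
        + (\<Sum>l=1..k. sym_var (i, l) * ?D (?S (k - l)))"
      unfolding Dnat[symmetric] S Dsum heis_annih_mult sum.distrib ..
    also have "(\<Sum>l=1..k. ?D (sym_var (i, l)) * ?S (k - l))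
        = (\<Sum>l=1..k. if l = j then of_nat j * ?N * ?S (k - j) else 0)"
      by (rule sum.cong) (auto simp: heis_annih_var)
    also have "\<dots> = (if j \<le> k then of_nat j * ?N * ?S (k - j) else 0)"
      using assms by (simp add: sum.delta)
    \<comment> \<open>The induction hypothesis and the recursion at k - j yield the factor k - j;
      together with the j from the first sum it gives k. For k < j truncated subtraction makes this
      sum 0.\<close>
    also have "(\<Sum>l=1..k. sym_var (i, l) * ?D (?S (k - l))) =
       (\<Sum>l=1..k-j. ?N * (sym_var (i, l) * ?S (k - j - l)))"
    proof (rule sum.mono_neutral_cong_right)
      show "\<forall>l\<in>{1..k} - {1..k - j}. sym_var (i, l) * ?D (?S (k - l)) = 0"
        using less False assms by auto
      show "sym_var (i, l) * ?D (?S (k - l)) = ?N * (sym_var (i, l) * ?S (k - j - l))"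
        if "l \<in> {1..k-j}" for l
      proof -
        from that have "j \<le> k - l" "k - l < k" "k - l - j = k - j - l" by auto
        then show ?thesis using less[of "k - l"] by (simp add: mult_ac)
      qed
    qed auto
    also have "\<dots> = ?N * (of_nat (k - j) * ?S (k - j))"
      by (simp only: S sum_distrib_left)
    finally have "of_nat k * ?D (?S k) = (if j \<le> k then of_nat j * ?N * ?S (k - j) else 0) + ?N * (of_nat (k - j) * ?S (k - j))" .
    also have "\<dots> = of_nat k * (if j \<le> k then ?N * ?S (k - j) else 0)"
      by (auto simp: of_nat_diff algebra_simps)
    finally show ?thesis using False by (auto dest: sym_of_nat_cancel)
  qed
qed

text \<open>The coefficient of \<open>z\<^sup>j\<close> in \<open>(1 - z)\<^sup>N\<close>.\<close>

definition comm_coeff :: "int \<Rightarrow> nat \<Rightarrow> int" where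
  "comm_coeff N j =
     (if 0 \<le> N then (- 1) ^ j * int (nat N choose j) else int ((j + nat (- N) - 1) choose j))"

text \<open>For negative N the second case of \<open>comm_coeff\<close> is upper negation; the
  generalised binomial treats both signs at once.\<close>

lemma of_int_comm_coeff: "of_int (comm_coeff N j) = (- 1) ^ j * (of_int N gchoose j :: 'a::field_char_0)"
proof -
  have "(- 1 :: 'a) ^ j * ((- 1) ^ j * x) = x" for x
    by (simp add: mult.assoc[symmetric] power_add[symmetric])
  then show ?thesis
    unfolding of_int_gbinomial[symmetric] gbinomial_int_binomial by (simp add: comm_coeff_def)
qed

text \<open>The coefficient form of z F' = -N z/(1 - z) F for F = (1 - z)^N. The proof evaluates the
  alternating partial sum of binomials and applies absorption.\<close>

lemma comm_coeff_rec: "int m * comm_coeff N m = - N * (\<Sum>j<m. comm_coeff N j)"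
proof (cases m)
  case (Suc k)
  have "(of_int (int m * comm_coeff N m) :: rat) = of_int (- N * (\<Sum>j<m. comm_coeff N j))"
    using gbinomial_sum_lower_neg[of "of_int N :: rat" k] gbinomial_absorption[of k "of_int N :: rat"]
    by (simp add: of_int_comm_coeff Suc lessThan_Suc_atMost mult_ac del: of_nat_Suc)
  then show ?thesis by (simp only: of_int_eq_iff)
qed simp

text \<open>By \<open>heis_annih_s\<close> annihilators only shift the index and multiply by the
  pairing, so the defining equation of r reduces to \<open>comm_coeff_rec\<close>.\<close>

lemma sym_r_s_one:
  "sym_r \<alpha> m (sym_s (simple_root i) k 1) =
     (if m \<le> k then of_int (comm_coeff (simple_pairing \<alpha> i) m) * sym_s (simple_root i) (k - m) 1 else 0)"
proof (rule exp_series_unique[OF exp_series_r])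
  let ?S = "\<lambda>k. sym_s (simple_root i) k 1"
  let ?c = "\<lambda>m. of_int (comm_coeff (simple_pairing \<alpha> i) m) :: sym"
  let ?D = "heis_annih (to_cartan \<alpha>)"
  let ?F = "\<lambda>m. if m \<le> k then ?c m * ?S (k - m) else 0"
  have Dint: "?D j (of_int l * f) = of_int l * ?D j f" for l f j
    using sym_deriv_scale[of _ "of_int l" f] by (simp add: heis_annih_def)
  have D0: "?D j 0 = 0" for j using heis_annih_add[of _ _ 0 0] by simp
  show "exp_series (\<lambda>j f. - ?D j f) ?F"
    unfolding exp_series_def
  proof
    fix m
    \<comment> \<open>The bounds m - j \<le> k and j \<le> k - (m - j) together amount to m \<le>
      k.\<close>
    have t: "- ?D j (?F (m - j)) = (if m \<le> k then - of_int (simple_pairing \<alpha> i) * ?c (m - j) * ?S (k - m) else 0)"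
      if "j \<in> {1..m}" for j
      using that by (auto simp: Dint heis_annih_s D0 mult_ac)
    have "(\<Sum>j=1..m. - ?D j (?F (m - j)))
        = (if m \<le> k then - of_int (simple_pairing \<alpha> i) * (\<Sum>j=1..m. ?c (m - j)) * ?S (k - m) else 0)"
      by (simp only: t cong: sum.cong) (simp add: sum_distrib_left sum_distrib_right)
    also have "(\<Sum>j=1..m. ?c (m - j)) = (\<Sum>j<m. ?c j)"
      by (rule sum.reindex_bij_witness[of _ "\<lambda>j. m - j" "\<lambda>j. m - j"]) auto
    also have "- of_int (simple_pairing \<alpha> i) * (\<Sum>j<m. ?c j) = of_nat m * ?c m"
      using arg_cong[OF comm_coeff_rec[of m "simple_pairing \<alpha> i"], of "of_int :: int \<Rightarrow> sym"] by simp
    finally show "of_nat m * ?F m = (\<Sum>j=1..m. - ?D j (?F (m - j)))"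
      by (simp add: mult.assoc)
  qed
qed (simp add: sym_r_0 comm_coeff_def)

text \<open>Multiplicativity of E^+ combined with \<open>sym_r_s_one\<close>; terms with j > k
  vanish.\<close>

lemma sym_r_s:
  "sym_r \<alpha> m (sym_s (simple_root i) k f) =
     (\<Sum>j\<le>min m k. of_int (comm_coeff (simple_pairing \<alpha> i) j) *
        sym_s (simple_root i) (k - j) (sym_r \<alpha> (m - j) f))"
proof -
  have "sym_r \<alpha> m (sym_s (simple_root i) k f) =
      (\<Sum>j\<le>m. sym_r \<alpha> j (sym_s (simple_root i) k 1) * sym_r \<alpha> (m - j) f)"
    by (subst sym_s_mult) (rule sym_r_mult)
  also have "\<dots> = (\<Sum>j\<le>min m k. of_int (comm_coeff (simple_pairing \<alpha> i) j) *
        (sym_s (simple_root i) (k - j) 1 * sym_r \<alpha> (m - j) f))"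
    by (rule sum.mono_neutral_cong_right) (auto simp: sym_r_s_one mult_ac)
  finally show ?thesis by (simp only: sym_s_mult[of _ _ "sym_r _ _ _"])
qed

lemma sym_r_one: "m > 0 \<Longrightarrow> sym_r \<alpha> m 1 = 0"
proof (induction m rule: less_induct)
  case (less m)
  have D: "heis_annih h j 0 = 0" "heis_annih h j 1 = 0" for h j
    using sym_deriv_const[of _ 0] sym_deriv_const[of _ 1] by (simp_all add: heis_annih_def)
  have "heis_annih (to_cartan \<alpha>) j (sym_r \<alpha> (m - j) 1) = 0" if "j \<in> {1..m}" for j
    using that less(1)[of "m - j"] by (cases "m = j") (auto simp: D sym_r_0)
  then have "of_nat m * sym_r \<alpha> m 1 = of_nat m * 0"
    using exp_series_r[of \<alpha> 1] by (simp add: exp_series_def)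
  then show ?case using less(2) by (rule sym_of_nat_cancel)
qed

subsection \<open>The integral form\<close>

lemma lookup_of_int_mult:
  fixes f :: "'a::monoid_add \<Rightarrow>\<^sub>0 'b::ring_1"
  shows "Poly_Mapping.lookup (of_int d * f) k = of_int d * Poly_Mapping.lookup f k"
proof -
  have nat: "Poly_Mapping.lookup (of_nat l * f) k = of_nat l * Poly_Mapping.lookup f k" for l
    by (induction l) (simp_all add: distrib_right lookup_add)
  show ?thesis
    by (cases d rule: int_diff_cases) (simp add: left_diff_distrib lookup_minus nat)
qed

text \<open>\<open>Poly_Mapping.map\<close> skips zero coefficients, which is harmless because
  \<open>sym_s\<close> sends 0 to 0.\<close>

lemma lookup_s_op: "Poly_Mapping.lookup (s_op \<alpha> m v) \<gamma> = sym_s \<alpha> m (Poly_Mapping.lookup v \<gamma>)"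
  using sym_s_mult[of \<alpha> m 0] by (simp add: s_op_def map.rep_eq when_def)

lemma lookup_r_op: "Poly_Mapping.lookup (r_op \<alpha> m v) \<gamma> = sym_r \<alpha> m (Poly_Mapping.lookup v \<gamma>)"
  using sym_r_add[of \<alpha> m 0 0] by (simp add: r_op_def map.rep_eq when_def)

lemma s_op_add: "s_op \<alpha> m (u + v) = s_op \<alpha> m u + s_op \<alpha> m v"
  by (rule poly_mapping_eqI) (simp add: lookup_s_op lookup_add sym_s_add)

lemma r_op_add: "r_op \<alpha> m (u + v) = r_op \<alpha> m u + r_op \<alpha> m v"
  by (rule poly_mapping_eqI) (simp add: lookup_r_op lookup_add sym_r_add)

lemma s_op_0: "s_op \<alpha> 0 v = v"
  by (rule poly_mapping_eqI) (simp add: lookup_s_op sym_s_0)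

lemma s_op_plus: "s_op (\<alpha> + \<beta>) m v = (\<Sum>i\<le>m. s_op \<alpha> i (s_op \<beta> (m - i) v))"
  by (rule poly_mapping_eqI) (simp add: lookup_s_op lookup_sum sym_s_plus)

lemma s_op_zero_lat: "s_op 0 m v = (if m = 0 then v else 0)"
proof -
  have "sym_elem (to_cartan 0) j = 0" for j
    using sym_elem_superset[of "{}" "to_cartan 0" j] by (simp add: to_cartan_def map_eq_zero_iff)
  then have "of_nat m * sym_s 0 m f = of_nat m * 0" for f
    using exp_series_s[of 0 f] by (simp add: exp_series_def)
  then have "sym_s 0 m f = 0" if "m > 0" for f
    using that by (rule sym_of_nat_cancel)
  then show ?thesis
    by (auto simp: s_op_0 lookup_s_op intro: poly_mapping_eqI)
qed

lemma r_op_iota: "r_op \<alpha> m (iota \<gamma>) = (if m = 0 then iota \<gamma> else 0)"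
  using sym_r_add[of \<alpha> m 0 0]
  by (intro poly_mapping_eqI) (auto simp: lookup_r_op iota_def lookup_single when_def sym_r_0 sym_r_one)

lemma r_op_s_op:
  "r_op \<alpha> m (s_op (simple_root i) k v) =
     (\<Sum>j\<le>min m k. of_int (comm_coeff (simple_pairing \<alpha> i) j) *
        s_op (simple_root i) (k - j) (r_op \<alpha> (m - j) v))"
  by (rule poly_mapping_eqI) (simp add: lookup_r_op lookup_s_op lookup_sum lookup_of_int_mult sym_r_s)

section \<open>Stability of the integral form under the operators\<close>

definition add_subgroup :: "'a::ab_group_add set \<Rightarrow> bool" where
  "add_subgroup W \<longleftrightarrow> 0 \<in> W \<and> (\<forall>x\<in>W. \<forall>y\<in>W. x - y \<in> W)"

lemma add_subgroup_group_closure: "add_subgroup (group_closure S)"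
  by (simp add: add_subgroup_def group_closure.diff)

lemma add_subgroup_V_int: "add_subgroup (V_int n)"
  unfolding V_int_def by (rule add_subgroup_group_closure)

lemma add_subgroup_diff: "add_subgroup W \<Longrightarrow> x \<in> W \<Longrightarrow> y \<in> W \<Longrightarrow> x - y \<in> W"
  by (simp add: add_subgroup_def)

lemma add_subgroup_zero: "add_subgroup W \<Longrightarrow> 0 \<in> W"
  by (simp add: add_subgroup_def)

lemma add_subgroup_add:
  assumes "add_subgroup W" "x \<in> W" "y \<in> W"
  shows "x + y \<in> W"
  using add_subgroup_diff[OF assms(1,2) add_subgroup_diff[OF assms(1) add_subgroup_zero[OF assms(1)] assms(3)]]
  by simp

lemma add_subgroup_sum:
  assumes "add_subgroup W" "\<And>x. x \<in> A \<Longrightarrow> h x \<in> W"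
  shows "sum h A \<in> W"
  using assms(2)
  by (induction A rule: infinite_finite_induct) (simp_all add: add_subgroup_zero add_subgroup_add assms(1))

lemma add_subgroup_of_int_mult:
  fixes x :: "'a::ring_1"
  assumes W: "add_subgroup W" and x: "x \<in> W"
  shows "of_int d * x \<in> W"
proof -
  have "of_nat k * x \<in> W" for k
    by (induction k) (simp_all add: distrib_right add_subgroup_zero add_subgroup_add assms)
  then show ?thesis
    by (cases d rule: int_diff_cases) (simp add: left_diff_distrib add_subgroup_diff W)
qed

lemma add_subgroup_group_closure_image:
  fixes T :: "'a::ab_group_add \<Rightarrow> 'b::ab_group_add"
  assumes add: "\<And>x y. T (x + y) = T x + T y" and W: "add_subgroup W"
    and gen: "\<And>x. x \<in> S \<Longrightarrow> T x \<in> W" and "v \<in> group_closure S"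
  shows "T v \<in> W"
proof -
  have 0: "T 0 = 0" using add[of 0 0] by simp
  have diff: "T (x - y) = T x - T y" for x y using add[of "x - y" y] by (simp add: algebra_simps)
  show ?thesis
    using assms(4) by induction (use W gen in \<open>auto simp: 0 diff add_subgroup_def\<close>)
qed

abbreviation V_gen :: "(lat \<times> nat) list \<Rightarrow> lat \<Rightarrow> latVA" where
  "V_gen ks \<alpha> \<equiv> foldr (\<lambda>(\<beta>, m). s_op \<beta> m) ks (iota \<alpha>)"

lemma V_gen_in_V_int:
  "set ks \<subseteq> simple_roots n \<times> {1..} \<Longrightarrow> \<alpha> \<in> root_lattice n \<Longrightarrow> V_gen ks \<alpha> \<in> V_int n"
  unfolding V_int_def by (intro group_closure.base) blast

lemma iota_in_V_int: "\<alpha> \<in> root_lattice n \<Longrightarrow> iota \<alpha> \<in> V_int n"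
  using V_gen_in_V_int[of "[]"] by simp

lemma V_int_map:
  assumes add: "\<And>x y. T (x + y) = T x + T y" and W: "add_subgroup W"
    and gen: "\<And>ks \<alpha>. set ks \<subseteq> simple_roots n \<times> {1..} \<Longrightarrow> \<alpha> \<in> root_lattice n \<Longrightarrow> T (V_gen ks \<alpha>) \<in> W"
    and v: "v \<in> V_int n"
  shows "T v \<in> W"
  using v unfolding V_int_def
  by (rule add_subgroup_group_closure_image[of T, OF add W, rotated]) (use gen in blast)

lemma s_op_simple_V_int:
  assumes "\<beta> \<in> simple_roots n" "v \<in> V_int n"
  shows "s_op \<beta> k v \<in> V_int n"
\<comment> \<open>Generators of \<open>V_int\<close> carry only positive indices, so index 0, where
  s is the identity, is treated apart.\<close>
proof (cases "k = 0")
  case False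
  show ?thesis
  proof (rule V_int_map[OF s_op_add add_subgroup_V_int _ assms(2)])
    show "s_op \<beta> k (V_gen ks \<alpha>) \<in> V_int n"
      if "set ks \<subseteq> simple_roots n \<times> {1..}" "\<alpha> \<in> root_lattice n" for ks :: "(lat \<times> nat) list" and \<alpha>
      using V_gen_in_V_int[of "(\<beta>, k) # ks" n \<alpha>] that False assms(1) by simp
  qed
qed (simp add: s_op_0 assms)

text \<open>By \<open>r_op_s_op\<close>, r moves to the right through a generator with integer
  coefficients, and on \<open>iota\<close> only index 0 survives.\<close>

lemma r_op_V_int:
  assumes "v \<in> V_int n"
  shows "r_op \<alpha> m v \<in> V_int n"
proof (rule V_int_map[OF r_op_add add_subgroup_V_int _ assms])
  fix ks :: "(lat \<times> nat) list" and \<gamma> assume "set ks \<subseteq> simple_roots n \<times> {1..}" and \<gamma>: "\<gamma> \<in> root_lattice n"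
  then show "r_op \<alpha> m (V_gen ks \<gamma>) \<in> V_int n"
  proof (induction ks arbitrary: m)
    case Nil
    show ?case using \<gamma> add_subgroup_V_int[of n] by (simp add: r_op_iota iota_in_V_int add_subgroup_def)
  next
    case (Cons x ks)
    then obtain i k where x: "x = (simple_root i, k)" and i: "simple_root i \<in> simple_roots n"
      by (cases x) (auto simp: simple_roots_def)
    show ?case
      using Cons i add_subgroup_V_int[of n]
      by (auto simp: x r_op_s_op intro!: add_subgroup_sum add_subgroup_of_int_mult s_op_simple_V_int)
  qed
qed

section \<open>The vector eta and divisibility by p\<close>

lemma simple_root_in_root_lattice: "\<beta> \<in> simple_roots n \<Longrightarrow> \<beta> \<in> root_lattice n"
  by (auto simp: simple_roots_def simple_root_def root_lattice_def)

lemma lookup_eta: "Poly_Mapping.lookup (eta n) j = (if j \<in> {1..n} then int j else 0)"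
  by (auto simp: eta_def lookup_sum lookup_single when_def sum.delta)

lemma eta_in_root_lattice: "eta n \<in> root_lattice n"
  by (auto simp: root_lattice_def in_keys_iff lookup_eta split: if_splits)

text \<open>eta is a sum of simple roots with repetition, and by \<open>s_op_plus\<close> the
  stability property is closed under addition.\<close>

lemma s_op_eta_V_int:
  assumes "v \<in> V_int n"
  shows "s_op (eta n) m v \<in> V_int n"
proof -
  define P where "P \<alpha> \<longleftrightarrow> (\<forall>m. \<forall>v\<in>V_int n. s_op \<alpha> m v \<in> V_int n)" for \<alpha>
  have P0: "P 0" using add_subgroup_V_int[of n] by (simp add: P_def s_op_zero_lat add_subgroup_def)
  have Padd: "P (\<alpha> + \<beta>)" if "P \<alpha>" "P \<beta>" for \<alpha> \<beta>
    using that add_subgroup_V_int[of n] by (auto simp: P_def s_op_plus intro!: add_subgroup_sum)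
  have "P (Poly_Mapping.single i (int k))" if "i \<in> {1..n}" for i k
  proof (induction k)
    case (Suc k)
    have "P (simple_root i)"
      using that by (auto simp: P_def simple_roots_def intro!: s_op_simple_V_int)
    from Padd[OF this Suc] show ?case by (simp add: simple_root_def single_add[symmetric])
  qed (simp add: P0)
  then have "P (\<Sum>i\<in>A. Poly_Mapping.single i (int i))" if "A \<subseteq> {1..n}" for A
    using that by (induction A rule: infinite_finite_induct) (auto simp: P0 Padd)
  then have "P (eta n)" unfolding eta_def by blast
  with assms show ?thesis by (simp add: P_def)
qed

text \<open>The coordinates of eta are linear in the index and the Cartan matrix takes second
  differences, so only at i = n does the missing neighbour n + 1 leave a remainder.\<close>

lemma simple_pairing_eta:
  assumes "i \<in> {1..n}"
  shows "simple_pairing (eta n) i = int (if i = n then n + 1 else 0)"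
proof -
  have "simple_pairing (eta n) i = (\<Sum>j=1..n. int j * cartan_A j i)"
    unfolding simple_pairing_def
    by (rule sum.mono_neutral_cong_left) (auto simp: in_keys_iff lookup_eta split: if_splits)
  also have "\<dots> = (\<Sum>j=1..n. (if j = i then 2 * int j else 0) - (if j = i - 1 then int j else 0)
      - (if j = Suc i then int j else 0))"
    using assms by (intro sum.cong) (auto simp: cartan_A_def)
  also have "\<dots> = int (if i = n then n + 1 else 0)"
    using assms by (auto simp: sum_subtractf)
  finally show ?thesis .
qed

text \<open>By absorption p^r divides j times the binomial; if p did not divide the binomial, p^r
  would divide j.\<close>

lemma prime_dvd_binomial:
  fixes p :: nat
  assumes "prime p" "p ^ r dvd N" "\<not> p ^ r dvd j"
  shows "p dvd N choose j"
proof (rule ccontr)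
  assume "\<not> p dvd N choose j"
  with assms(1) have cop: "coprime (p ^ r) (N choose j)"
    by (simp add: prime_imp_coprime)
  from assms(3) obtain k where "j = Suc k" by (cases j) auto
  then have "j * (N choose j) = N * ((N - 1) choose k)" by (simp only: binomial_absorption)
  then have "p ^ r dvd j * (N choose j)" using assms(2) by simp
  with cop assms(3) show False by (simp add: coprime_dvd_mult_left_iff)
qed

text \<open>The commutation coefficients of \<open>r\<^sub>\<eta>\<close> are those of \<open>(1 - z)\<^sup>n\<^sup>+\<^sup>1\<close> or of \<open>1\<close>;
  modulo \<open>p\<close> both are polynomials in \<open>z\<^sup>q\<close>.\<close>

lemma r_op_eta_dvd:
  assumes p: "prime p" and n: "p ^ r dvd n + 1" and m: "\<not> p ^ r dvd m" and v: "v \<in> V_int n"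
  shows "\<exists>w\<in>V_int n. r_op (eta n) m v = of_int (int p) * w"
proof -
  \<comment> \<open>Vanishing modulo p means membership in W, a subgroup, so that generators
    suffice.\<close>
  define W where "W = (*) (of_int (int p)) ` V_int n"
  have W: "add_subgroup W"
    unfolding add_subgroup_def
  proof (intro conjI ballI)
    show "0 \<in> W"
      using add_subgroup_V_int[of n] unfolding W_def add_subgroup_def by (intro image_eqI[of _ _ 0]) auto
    fix x y assume "x \<in> W" "y \<in> W"
    then obtain x' y' where "x = of_int (int p) * x'" "y = of_int (int p) * y'" "x' \<in> V_int n" "y' \<in> V_int n"
      by (auto simp: W_def)
    then show "x - y \<in> W"
      using add_subgroup_V_int[of n] unfolding W_def add_subgroup_def
      by (intro image_eqI[of _ _ "x' - y'"]) (auto simp: right_diff_distrib)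
  qed
  have "r_op (eta n) m v \<in> W"
  proof (rule V_int_map[OF r_op_add W _ v])
    fix ks :: "(lat \<times> nat) list" and \<gamma> assume "set ks \<subseteq> simple_roots n \<times> {1..}" and \<gamma>: "\<gamma> \<in> root_lattice n"
    then show "r_op (eta n) m (V_gen ks \<gamma>) \<in> W"
      using m
    proof (induction ks arbitrary: m)
      case Nil
      have "m \<noteq> 0"
      proof
        assume "m = 0"
        with Nil show False by simp
      qed
      then show ?case using W by (simp add: r_op_iota add_subgroup_def)
    next
      case (Cons x ks)
      then obtain i k where x: "x = (simple_root i, k)" and i: "i \<in> {1..n}"
        by (cases x) (auto simp: simple_roots_def)
      then have si: "simple_root i \<in> simple_roots n" by (simp add: simple_roots_def)
      have ks: "V_gen ks \<gamma> \<in> V_int n" using Cons \<gamma> by (intro V_gen_in_V_int) auto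
      let ?c = "comm_coeff (simple_pairing (eta n) i)"
      have "of_int (?c j) * s_op (simple_root i) (k - j) (r_op (eta n) (m - j) (V_gen ks \<gamma>)) \<in> W"
        (is "of_int _ * ?u \<in> W") if "j \<le> min m k" for j
      \<comment> \<open>If p^r divides j, it does not divide m - j and the induction hypothesis
        applies; otherwise p divides the coefficient.\<close>
      proof (cases "p ^ r dvd j")
        case True
        then have "\<not> p ^ r dvd m - j"
          using that Cons.prems(3) dvd_diffD[of "p ^ r" m j] by auto
        with Cons have "r_op (eta n) (m - j) (V_gen ks \<gamma>) \<in> W" by auto
        then obtain w where w: "w \<in> V_int n" "r_op (eta n) (m - j) (V_gen ks \<gamma>) = of_int (int p) * w"
          by (auto simp: W_def)
        have "?u = of_int (int p) * s_op (simple_root i) (k - j) w"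
          unfolding w(2)
          by (rule poly_mapping_eqI) (simp add: lookup_s_op lookup_of_int_mult sym_s_mult[of _ _ "_ * _"]
              sym_s_mult[of _ _ "Poly_Mapping.lookup w _"] mult.left_commute del: of_int_of_nat_eq)
        then have "?u \<in> W" using s_op_simple_V_int[OF si w(1)] by (auto simp: W_def)
        then show ?thesis by (rule add_subgroup_of_int_mult[OF W])
      next
        case False
        \<comment> \<open>Both pairings are covered, since p^r divides n + 1 and 0.\<close>
        have "p dvd (if i = n then n + 1 else 0) choose j"
          by (rule prime_dvd_binomial[OF p _ False]) (use n in simp)
        then have "int p dvd ?c j"
          by (simp add: simple_pairing_eta[OF i] comm_coeff_def)
        then obtain d where d: "?c j = int p * d" ..
        have "of_int d * ?u \<in> V_int n"
          by (intro add_subgroup_of_int_mult add_subgroup_V_int s_op_simple_V_int si r_op_V_int ks)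
        then show ?thesis
          unfolding W_def by (rule image_eqI[rotated]) (simp add: d mult.assoc)
      qed
      then show ?case
        unfolding x by (simp add: r_op_s_op) (intro add_subgroup_sum[OF W], simp)
    qed
  qed
  then show ?thesis by (auto simp: W_def)
qed

subsection \<open>Extension of scalars\<close>

lemma add_subgroup_tensor_rel: "add_subgroup (tensor_rel M)"
  unfolding tensor_rel_def by (rule add_subgroup_group_closure)

lemma tensor_rel_add_left:
  "u \<in> M \<Longrightarrow> v \<in> M \<Longrightarrow> frag_of (u + v, c) - frag_of (u, c) - frag_of (v, c) \<in> tensor_rel M"
  unfolding tensor_rel_def by (intro group_closure.base) blast

lemma tensor_rel_add_right:
  "u \<in> M \<Longrightarrow> frag_of (u, c + d) - frag_of (u, c) - frag_of (u, d) \<in> tensor_rel M"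
  unfolding tensor_rel_def by (intro group_closure.base) blast

lemma tensor_class_self: "x \<in> tensor_class M x"
  by (simp add: tensor_class_def add_subgroup_zero[OF add_subgroup_tensor_rel])

lemma tensor_class_eqI:
  assumes "y - x \<in> tensor_rel M"
  shows "tensor_class M y = tensor_class M x"
proof -
  have "z - y \<in> tensor_rel M \<longleftrightarrow> z - x \<in> tensor_rel M" for z
  proof
    assume "z - y \<in> tensor_rel M"
    from add_subgroup_add[OF add_subgroup_tensor_rel this assms] show "z - x \<in> tensor_rel M" by simp
  next
    assume "z - x \<in> tensor_rel M"
    then have "(z - x) - (y - x) \<in> tensor_rel M"
      using add_subgroup_tensor_rel[of M] assms unfolding add_subgroup_def by blast
    then show "z - y \<in> tensor_rel M" by simp
  qed
  then show ?thesis by (simp add: tensor_class_def)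
qed

text \<open>The definition is a union over representatives; all its cosets coincide and there is at
  least one.\<close>

lemma tensor_add_class:
  "tensor_add M (tensor_class M x) (tensor_class M y) = tensor_class M (x + y)"
proof -
  have "tensor_class M (x' + y') = tensor_class M (x + y)"
    if "x' \<in> tensor_class M x" "y' \<in> tensor_class M y" for x' y'
  proof (rule tensor_class_eqI)
    have "(x' - x) + (y' - y) \<in> tensor_rel M"
      using that by (intro add_subgroup_add[OF add_subgroup_tensor_rel]) (auto simp: tensor_class_def)
    then show "x' + y' - (x + y) \<in> tensor_rel M" by (simp add: algebra_simps)
  qed
  then have "tensor_add M (tensor_class M x) (tensor_class M y) =
      (\<Union>x'\<in>tensor_class M x. \<Union>y'\<in>tensor_class M y. tensor_class M (x + y))"
    unfolding tensor_add_def by (intro SUP_cong refl)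
  moreover have "tensor_class M x \<noteq> {}" "tensor_class M y \<noteq> {}"
    using tensor_class_self[of x M] tensor_class_self[of y M] by auto
  ultimately show ?thesis by simp
qed

text \<open>As f respects both kinds of relations, its extension preserves
  \<open>tensor_rel\<close>. This makes scaling and induced maps independent of
  representatives.\<close>

lemma frag_extend_class:
  assumes "\<And>u v c. u \<in> M \<Longrightarrow> v \<in> M \<Longrightarrow> f (u + v, c) - f (u, c) - f (v, c) \<in> tensor_rel M"
    and "\<And>u c d. u \<in> M \<Longrightarrow> f (u, c + d) - f (u, c) - f (u, d) \<in> tensor_rel M"
  shows "(\<Union>y\<in>tensor_class M x. tensor_class M (frag_extend f y)) = tensor_class M (frag_extend f x)"
proof -
  have rel: "frag_extend f z \<in> tensor_rel M" if "z \<in> tensor_rel M" for z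
    using that unfolding tensor_rel_def[of M]
    by (rule add_subgroup_group_closure_image[OF frag_extend_add add_subgroup_group_closure, rotated])
      (use assms in \<open>auto simp: frag_extend_diff tensor_rel_def\<close>)
  have "tensor_class M (frag_extend f y) = tensor_class M (frag_extend f x)" if "y \<in> tensor_class M x" for y
    using that rel[of "y - x"] by (intro tensor_class_eqI) (simp add: tensor_class_def frag_extend_diff)
  then have "(\<Union>y\<in>tensor_class M x. tensor_class M (frag_extend f y)) =
      (\<Union>y\<in>tensor_class M x. tensor_class M (frag_extend f x))"
    by (intro SUP_cong refl)
  moreover have "tensor_class M x \<noteq> {}"
    using tensor_class_self[of x M] by auto
  ultimately show ?thesis by simp
qed

lemma tensor_scale_class:
  "tensor_scale M c (tensor_class M x) = tensor_class M (frag_extend (\<lambda>(u, d). frag_of (u, c * d)) x)"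
  unfolding tensor_scale_def
  by (rule frag_extend_class) (simp_all add: tensor_rel_add_left tensor_rel_add_right distrib_left)

lemma tensor_map_class:
  assumes "\<And>u v. T (u + v) = T u + T v" "\<And>u. u \<in> M \<Longrightarrow> T u \<in> M"
  shows "tensor_map M T (tensor_class M x) = tensor_class M (frag_extend (\<lambda>(u, d). frag_of (T u, d)) x)"
  unfolding tensor_map_def
  by (rule frag_extend_class) (simp_all add: tensor_rel_add_left tensor_rel_add_right assms)

lemma frag_extend_class_in_space:
  assumes "Poly_Mapping.keys x \<subseteq> M \<times> UNIV" "\<And>u c. u \<in> M \<Longrightarrow> Poly_Mapping.keys (f (u, c)) \<subseteq> M \<times> UNIV"
  shows "tensor_class M (frag_extend f x) \<in> tensor_space M"
proof -
  have "Poly_Mapping.keys (frag_extend f x) \<subseteq> M \<times> UNIV"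
    using keys_frag_extend[of f x] assms by fast
  then show ?thesis by (auto simp: tensor_space_def)
qed

lemma tensor_space_cases:
  assumes "X \<in> tensor_space M"
  obtains x where "X = tensor_class M x" "Poly_Mapping.keys x \<subseteq> M \<times> UNIV"
  using assms by (auto simp: tensor_space_def)

lemma tensor_map_in_space:
  assumes "\<And>u v. T (u + v) = T u + T v" "\<And>u. u \<in> M \<Longrightarrow> T u \<in> M" "X \<in> tensor_space M"
  shows "tensor_map M T X \<in> tensor_space M"
proof -
  obtain x where x: "X = tensor_class M x" "Poly_Mapping.keys x \<subseteq> M \<times> UNIV"
    using assms(3) by (rule tensor_space_cases)
  show ?thesis
    unfolding x(1)
    by (subst tensor_map_class[OF assms(1,2)])
      (simp_all add: frag_extend_class_in_space x(2) assms(2))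
qed

lemma tensor_scale_in_space:
  assumes "X \<in> tensor_space M"
  shows "tensor_scale M c X \<in> tensor_space M"
proof -
  obtain x where x: "X = tensor_class M x" "Poly_Mapping.keys x \<subseteq> M \<times> UNIV"
    using assms by (rule tensor_space_cases)
  show ?thesis
    unfolding x(1) tensor_scale_class
    by (rule frag_extend_class_in_space[OF x(2)]) simp
qed

lemma tensor_add_in_space:
  assumes "X \<in> tensor_space M" "Y \<in> tensor_space M"
  shows "tensor_add M X Y \<in> tensor_space M"
proof -
  from assms obtain x y where xy: "X = tensor_class M x" "Y = tensor_class M y"
    "Poly_Mapping.keys x \<subseteq> M \<times> UNIV" "Poly_Mapping.keys y \<subseteq> M \<times> UNIV"
    by (metis tensor_space_cases)
  then have "Poly_Mapping.keys (x + y) \<subseteq> M \<times> UNIV"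
    using Poly_Mapping.keys_add[of x y] by blast
  then show ?thesis by (auto simp: xy tensor_add_class tensor_space_def)
qed

lemma tensor_zero_in_space: "tensor_class M 0 \<in> tensor_space M"
  by (auto simp: tensor_space_def intro!: image_eqI[of _ _ 0])

lemma pure_tensor_in_space: "u \<in> M \<Longrightarrow> pure_tensor M u c \<in> tensor_space M"
  by (auto simp: tensor_space_def pure_tensor_def)

section \<open>The radical and reduction modulo p\<close>

lemma tensor_bilinear_zero:
  assumes "tensor_bilinear M B" "X \<in> tensor_space M"
  shows "B (tensor_class M 0) X = 0" "B X (tensor_class M 0) = 0"
proof -
  let ?z = "tensor_class M 0"
  have "B (tensor_add M ?z ?z) X = B ?z X + B ?z X" "B X (tensor_add M ?z ?z) = B X ?z + B X ?z"
    using assms tensor_zero_in_space[of M] unfolding tensor_bilinear_def by blast+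
  then show "B ?z X = 0" "B X ?z = 0" by (simp_all only: tensor_add_class add_0_left add_cancel_right_left)
qed

text \<open>Since \<open>I_L\<close> is a hull, this reduces the inclusion to its
  generators.\<close>

lemma tensor_subspace_radical:
  assumes "tensor_bilinear (V_int n) B"
  shows "tensor_subspace (V_int n) (V_radical n B)"
  using assms unfolding tensor_subspace_def V_radical_def V_mod_def
  by (auto simp: tensor_zero_in_space tensor_add_in_space tensor_scale_in_space tensor_bilinear_zero)
    (auto simp: tensor_bilinear_def)

text \<open>In characteristic p, p w \<otimes> c = w \<otimes> p c = w \<otimes> 0 = 0.\<close>

lemma tensor_map_eq_zero:
  fixes M :: "'a::ring_1 set" and X :: "('a, 'f::field) tensor"
  assumes add: "\<And>u v. T (u + v) = T u + T v" and M: "add_subgroup M"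
    and char: "of_nat p = (0::'f)"
    and T: "\<And>u. u \<in> M \<Longrightarrow> \<exists>w\<in>M. T u = of_int (int p) * w"
    and X: "X \<in> tensor_space M"
  shows "tensor_map M T X = tensor_class M 0"
proof -
  let ?R = "tensor_rel M :: ('a \<times> 'f \<Rightarrow>\<^sub>0 int) set"
  note R = add_subgroup_tensor_rel[of M]
  have R_diff: "x - y \<in> ?R" if "x \<in> ?R" "y \<in> ?R" for x y
    using R that unfolding add_subgroup_def by blast
  have TM: "T u \<in> M" if "u \<in> M" for u using T[OF that] by (metis add_subgroup_of_int_mult[OF M])
  have multiple: "frag_of (of_nat k * w, c) - frag_of (w, of_nat k * c) \<in> ?R" if w: "w \<in> M" for k w c
  proof (induction k)
    case 0
    have "0 \<in> M" using M by (simp add: add_subgroup_def)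
    \<comment> \<open>Each bracket collapses to the negative of one generator, leaving
      \<open>frag_of (0, c) - frag_of (w, 0)\<close>.\<close>
    then have "(frag_of (w, 0 + 0) - frag_of (w, 0) - frag_of (w, 0)) -
        (frag_of (0 + 0, c) - frag_of (0, c) - frag_of (0, c)) \<in> ?R"
      by (intro R_diff tensor_rel_add_left tensor_rel_add_right w)
    then show ?case by simp
  next
    case (Suc k)
    have kw: "of_nat k * w \<in> M" using add_subgroup_of_int_mult[OF M w, of "int k"] by simp
    have "(frag_of (w + of_nat k * w, c) - frag_of (w, c) - frag_of (of_nat k * w, c)) -
       (frag_of (w, c + of_nat k * c) - frag_of (w, c) - frag_of (w, of_nat k * c)) \<in> ?R"
      by (intro R_diff tensor_rel_add_left tensor_rel_add_right w kw)
    from add_subgroup_add[OF R this Suc] show ?case by (simp add: distrib_right)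
  qed
  have T0: "frag_of (T u, c) \<in> ?R" if u: "u \<in> M" for u c
  proof -
    obtain w where w: "w \<in> M" "T u = of_nat p * w" using T[OF u] by auto
    have "(frag_of (of_nat p * w, c) - frag_of (w, of_nat p * c)) -
        (frag_of (w, 0 + 0) - frag_of (w, 0) - frag_of (w, 0)) \<in> ?R"
      by (intro R_diff multiple tensor_rel_add_right w)
    then show ?thesis by (simp add: char w)
  qed
  obtain x where x: "X = tensor_class M x" "Poly_Mapping.keys x \<subseteq> M \<times> UNIV"
    using X by (rule tensor_space_cases)
  from x(2) have "frag_extend (\<lambda>(u, d). frag_of (T u, d)) x \<in> ?R"
  proof (induction x rule: frag_induction)
    case zero
    show ?case by (simp add: add_subgroup_zero[OF R])
  next
    case (one y)
    then show ?case by (cases y) (simp add: T0)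
  next
    case (diff a b)
    then show ?case by (simp add: frag_extend_diff R_diff)
  qed
  then show ?thesis
    unfolding x(1) by (subst tensor_map_class[OF add TM]) (simp_all add: tensor_class_eqI)
qed

theorem lemma4p5:
  fixes p n a r :: nat
    and B :: "'f::alg_closed_field mod_latVA \<Rightarrow> 'f mod_latVA \<Rightarrow> 'f"
  assumes "prime p" and "p > 2" and "CHAR('f) = p"
    and "n \<ge> 1" and "[n + 1 = 0] (mod p)"
    and "a > 0" and "r > 0" and "n + 1 = a * p ^ r" and "gcd a p = 1"
    and "is_V_form n B"
  shows "I_L n (p ^ r) \<subseteq> V_radical n B"
  unfolding I_L_def
proof (rule hull_minimal)
  from assms(10) have bil: "tensor_bilinear (V_int n) B"
    and adj: "\<And>\<alpha> m u v. \<lbrakk>\<alpha> \<in> root_lattice n; u \<in> V_mod n; v \<in> V_mod n\<rbrakk>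
      \<Longrightarrow> B (s_mod n \<alpha> m u) v = B u (r_mod n \<alpha> m v)"
    unfolding is_V_form_def by blast+
  show "tensor_subspace (V_int n) (V_radical n B)"
    by (rule tensor_subspace_radical[OF bil])
  have char: "of_nat p = (0::'f)"
    using of_nat_CHAR[where 'a = 'f] assms(3) by simp
  have iota: "iota_mod n \<alpha> \<in> V_mod n" if "\<alpha> \<in> root_lattice n" for \<alpha>
    using that unfolding iota_mod_def V_mod_def by (intro pure_tensor_in_space iota_in_V_int)
  have s_eta: "s_mod n (eta n) m X \<in> V_mod n" if "X \<in> V_mod n" for m and X :: "'f mod_latVA"
    using that unfolding s_mod_def V_mod_def by (intro tensor_map_in_space s_op_add s_op_eta_V_int)
  have s_simple: "s_mod n \<beta> m X \<in> V_mod n" if "\<beta> \<in> simple_roots n" "X \<in> V_mod n"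
    for \<beta> m and X :: "'f mod_latVA"
    using that unfolding s_mod_def V_mod_def by (intro tensor_map_in_space s_op_add s_op_simple_V_int)
  have r: "r_mod n \<beta> m X \<in> V_mod n" if "X \<in> V_mod n" for \<beta> m and X :: "'f mod_latVA"
    using that unfolding r_mod_def V_mod_def by (intro tensor_map_in_space r_op_add r_op_V_int)
  have r_eta: "r_mod n (eta n) m X = tensor_class (V_int n) 0"
    if "\<not> p ^ r dvd m" "X \<in> V_mod n" for m and X :: "'f mod_latVA"
    unfolding r_mod_def
  proof (rule tensor_map_eq_zero[OF r_op_add add_subgroup_V_int char])
    show "X \<in> tensor_space (V_int n)" using that(2) by (simp add: V_mod_def)
    show "\<exists>w\<in>V_int n. r_op (eta n) m u = of_int (int p) * w" if "u \<in> V_int n" for u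
      using \<open>\<not> p ^ r dvd m\<close> that assms(8) by (intro r_op_eta_dvd[OF assms(1)]) auto
  qed
  show "{foldr (\<lambda>(\<beta>, k). s_mod n \<beta> k) ks (s_mod n (eta n) m (iota_mod n \<alpha>)) | ks m \<alpha>.
        set ks \<subseteq> simple_roots n \<times> {1..} \<and> m \<ge> 1 \<and> \<not> p ^ r dvd m \<and> \<alpha> \<in> root_lattice n}
      \<subseteq> V_radical n B"
  proof clarify
    fix ks :: "(lat \<times> nat) list" and m \<alpha>
    assume ks: "set ks \<subseteq> simple_roots n \<times> {1..}" and m: "\<not> p ^ r dvd m" and \<alpha>: "\<alpha> \<in> root_lattice n"
    let ?X = "\<lambda>ks. foldr (\<lambda>(\<beta>, k). s_mod n \<beta> k) ks (s_mod n (eta n) m (iota_mod n \<alpha>)) :: 'f mod_latVA"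
    \<comment> \<open>Membership is carried along because adjointness is available only on
      \<open>V_mod n\<close>. In the base case s for eta crosses over as r, which is zero; each
      further s crosses over as an r that keeps v in \<open>V_mod n\<close>.\<close>
    have "?X ks \<in> V_mod n \<and> (\<forall>v\<in>V_mod n. B (?X ks) v = 0)"
      using ks
    proof (induction ks)
      case Nil
      show ?case
        using iota[OF \<alpha>] s_eta tensor_bilinear_zero(2)[OF bil]
        by (auto simp: adj eta_in_root_lattice r_eta[OF m] V_mod_def)
    next
      case (Cons x ks)
      then obtain \<beta> k where x: "x = (\<beta>, k)" and \<beta>: "\<beta> \<in> simple_roots n" by (cases x) auto
      with Cons show ?case
        by (auto simp: adj s_simple r simple_root_in_root_lattice)
    qed
    then show "?X ks \<in> V_radical n B" by (simp add: V_radical_def)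
  qed
qed

end
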